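(* Suppose that $r\ge d\ge 1$, $k\ge 1$, and $r_i\ge d_i\ge 0$ $(i=1,\ldots,k)$ are integers such that $r_1+\dotsb+r_k\le r$, $d_1+\dotsb+d_k\le d$, and $r_i\le d+d_i$ for $i=1,\ldots,k$. Then $$ \beta_r(d) \ge \binom{r_1}{d_1}\dotsb\binom{r_k}{d_k}. $$
   Context: Let $\mathbb{F}_2^r$ be the $r$-dimensional vector space over the two-element field, and let $0\le d\le r$ be an integer. A subset $B\subseteq\mathbb{F}_2^r$ is called $d$-non-blocking if for every $v\in\mathbb{F}_2^r$ there exists a linear subspace $L_v\le\mathbb{F}_2^r$ of codimension $d$ (that is, of dimension $r-d$) such that $(v+(L_v\setminus\{0\}))\cap B=\varnothing$. By $\beta_r(d)$ we denote the largest possible size of a $d$-non-blocking subset of $\mathbb{F}_2^r$. *)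

theory Defs
  imports "HOL-Analysis.Analysis" "HOL-Library.Z2"
begin

text \<open>
  The space \<open>\<F>\<^sub>2\<^sup>r\<close> is the type \<open>bit ^ 'r\<close> with \<open>r = CARD('r)\<close>; \<^const>\<open>vec.subspace\<close> and
  \<^const>\<open>vec.dim\<close> are the linear-algebra notions over the base field \<^typ>\<open>bit\<close>.
  The codimension condition is stated additively, so that no \<open>L\<close> qualifies when \<open>d > r\<close>.
\<close>

definition non_blocking :: "nat \<Rightarrow> (bit ^ 'r::finite) set \<Rightarrow> bool" where
  "non_blocking d B \<longleftrightarrow>
     (\<forall>v. \<exists>L. vec.subspace L \<and> vec.dim L + d = CARD('r) \<and>
              ((\<lambda>x. v + x) ` (L - {0})) \<inter> B = {})"

text \<open>
  The set below is finite, and for \<open>d \<le> r\<close> it contains 0, so \<^const>\<open>Max\<close> is meaningful;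
  for \<open>d > r\<close> the value is unspecified.
\<close>

definition beta :: "'r::finite itself \<Rightarrow> nat \<Rightarrow> nat" where
  "beta _ d = Max {card B |B :: (bit ^ 'r) set. non_blocking d B}"

lemma finite_UNIV_bit_vec: "finite (UNIV :: (bit ^ 'r::finite) set)"
proof -
  have "(UNIV :: bit set) \<subseteq> {0, 1}"
  proof
    fix x :: bit
    show "x \<in> {0, 1}" by (cases x) simp_all
  qed
  then have "finite (UNIV :: bit set)"
    using finite_subset by blast
  then have "finite {f :: 'r \<Rightarrow> bit. \<forall>i. f i \<in> (UNIV :: bit set)}"
    using finite_set_of_finite_funs[of "UNIV :: 'r set" "UNIV :: bit set" 0] by simp
  then have "finite (range (vec_lambda :: ('r \<Rightarrow> bit) \<Rightarrow> _))"
    by simp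
  moreover have "range (vec_lambda :: ('r \<Rightarrow> bit) \<Rightarrow> _) = UNIV"
    by (metis surjI vec_nth_inverse)
  ultimately show ?thesis by simp
qed

lemma finite_non_blocking_sizes:
  "finite {card B |B :: (bit ^ 'r::finite) set. non_blocking d B}"
proof -
  have "finite (UNIV :: (bit ^ 'r) set set)"
    using finite_UNIV_bit_vec by (simp add: Finite_Set.finite_set)
  then have "finite (range (card :: (bit ^ 'r) set \<Rightarrow> nat))" by simp
  then show ?thesis by (rule finite_subset[rotated]) auto
qed

lemma non_blocking_empty:
  assumes "d \<le> CARD('r)"
  shows "non_blocking d ({} :: (bit ^ 'r::finite) set)"
proof -
  have "CARD('r) - d \<le> vec.dim (UNIV :: (bit ^ 'r) set)"
    by (simp add: vec.dim_UNIV vec.dimension_def card_cart_basis)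
  then obtain L :: "(bit ^ 'r) set" where "vec.subspace L" "vec.dim L = CARD('r) - d"
    using vec.choose_subspace_of_subspace[of "CARD('r) - d" "UNIV :: (bit ^ 'r) set"] by blast
  with assms show ?thesis
    unfolding non_blocking_def by auto
qed

lemma beta_attained:
  assumes "d \<le> CARD('r)"
  shows "\<exists>B :: (bit ^ 'r::finite) set. non_blocking d B \<and> card B = beta TYPE('r) d"
proof -
  have "beta TYPE('r) d \<in> {card B |B :: (bit ^ 'r) set. non_blocking d B}"
    unfolding beta_def
    using non_blocking_empty[OF assms] by (intro Max_in finite_non_blocking_sizes) blast
  then show ?thesis by auto
qed

lemma card_le_beta:
  fixes B :: "(bit ^ 'r::finite) set"
  assumes "non_blocking d B"
  shows "card B \<le> beta TYPE('r) d"
  unfolding beta_def using assms by (intro Max_ge finite_non_blocking_sizes) blast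

end

theory Submission
  imports Defs
begin

text \<open>
  Fix disjoint coordinate blocks \<open>I i\<close> of size \<open>rs i\<close> and let \<open>B\<close> consist of the vectors that vanish
  outside the blocks and have weight exactly \<open>ds i\<close> on the block \<open>I i\<close>.
  If \<open>v \<in> B\<close>, let \<open>L\<close> be the vectors vanishing on the support of \<open>v\<close>, which has size at most \<open>d\<close>:
  a vector of \<open>B\<close> in \<open>v + L\<close> contains the support of \<open>v\<close> and has the same weights, so it is \<open>v\<close>.
  If \<open>v \<notin> B\<close>, then \<open>v + L\<close> has to miss \<open>B\<close>. If \<open>v\<close> is nonzero at a coordinate outside the blocks,
  fixing this coordinate suffices. Otherwise \<open>v\<close> has a wrong weight on some block. Then let \<open>L\<close> fix
  the ones (if there are too many) or the zeros (if there are too few) of \<open>v\<close> on this block; if there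
  are more than \<open>d\<close> of them, take \<open>d + 1\<close> of them and let \<open>L\<close> be the vectors constant on these
  coordinates: then each vector of \<open>v + L\<close> is constant there, so its weight on the block is at least
  \<open>d + 1 > ds i\<close> or at most \<open>rs i - (d + 1) < ds i\<close>.
\<close>

section \<open>Subspaces given by conditions on coordinates\<close>

lemma dim_vanishing:
  fixes S :: "'r::finite set"
  shows "vec.subspace {x :: 'a::field ^ 'r. \<forall>j\<in>S. x $ j = 0}"
    and "vec.dim {x :: 'a::field ^ 'r. \<forall>j\<in>S. x $ j = 0} + card S = CARD('r)"
proof -
  show "vec.subspace {x :: 'a ^ 'r. \<forall>j\<in>S. x $ j = 0}"
    by (auto simp: vec.subspace_def)
  have "vec.dim {x :: 'a ^ 'r. \<forall>i. i \<notin> - S \<longrightarrow> x $ i = 0} = card (- S)"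
    by (rule dim_substandard_cart)
  moreover have "{x :: 'a ^ 'r. \<forall>i. i \<notin> - S \<longrightarrow> x $ i = 0} = {x. \<forall>j\<in>S. x $ j = 0}"
    by auto
  moreover have "card (- S) + card S = CARD('r)"
    by (simp add: Compl_eq_Diff_UNIV card_Diff_subset card_mono)
  ultimately show "vec.dim {x :: 'a ^ 'r. \<forall>j\<in>S. x $ j = 0} + card S = CARD('r)"
    by simp
qed

text \<open>Beyond the vectors vanishing on \<open>T\<close>, this subspace contains the all-ones
  vector, which is not in their span. This gains a dimension, so constancy on \<open>d + 1\<close>
  coordinates costs codimension at most \<open>d\<close>.\<close>

lemma dim_constant_on:
  fixes T :: "'r::finite set"
  assumes "T \<noteq> {}"
  shows "vec.subspace {x :: 'a::field ^ 'r. \<exists>c. \<forall>j\<in>T. x $ j = c}"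
    and "CARD('r) < vec.dim {x :: 'a::field ^ 'r. \<exists>c. \<forall>j\<in>T. x $ j = c} + card T"
proof -
  let ?V = "{x :: 'a ^ 'r. \<forall>j\<in>T. x $ j = 0}"
  let ?L = "{x :: 'a ^ 'r. \<exists>c. \<forall>j\<in>T. x $ j = c}"
  let ?u = "(\<chi> j. 1) :: 'a ^ 'r"
  show "vec.subspace ?L"
    unfolding vec.subspace_def by (auto; metis)
  have "?u \<notin> vec.span ?V"
    using assms by (simp add: vec.span_eq_iff[THEN iffD2, OF dim_vanishing(1)])
  then have "vec.dim (insert ?u ?V) = vec.dim ?V + 1"
    by (simp add: vec.dim_insert)
  moreover have "vec.dim (insert ?u ?V) \<le> vec.dim ?L"
    by (intro vec.dim_subset) auto
  ultimately show "CARD('r) < vec.dim ?L + card T"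
    using dim_vanishing(2)[of T, where 'a='a] by simp
qed

text \<open>Shrinking \<open>L\<close> to a subspace of dimension exactly
  \<open>CARD('r) - d\<close> preserves avoidance, so codimension at most \<open>d\<close>
  suffices.\<close>

lemma non_blockingI:
  fixes B :: "(bit ^ 'r::finite) set"
  assumes d: "d \<le> CARD('r)"
    and L: "\<And>v. \<exists>L. vec.subspace L \<and> CARD('r) \<le> vec.dim L + d \<and> (\<forall>x\<in>L. v + x \<in> B \<longrightarrow> x = 0)"
  shows "non_blocking d B"
  unfolding non_blocking_def
proof
  fix v :: "bit ^ 'r"
  obtain L where L: "vec.subspace L" "CARD('r) - d \<le> vec.dim L" "\<forall>x\<in>L. v + x \<in> B \<longrightarrow> x = 0"
    using L[of v] by auto
  obtain M where "vec.subspace M" "M \<subseteq> vec.span L" "vec.dim M = CARD('r) - d"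
    using vec.choose_subspace_of_subspace[OF L(2)] by blast
  moreover have "vec.span L = L"
    using L(1) by simp
  ultimately show "\<exists>L. vec.subspace L \<and> vec.dim L + d = CARD('r) \<and>
      (+) v ` (L - {0}) \<inter> B = {}"
    using d L(3) by (intro exI[of _ M]) auto
qed

lemma avoid_weight:
  fixes v :: "bit ^ 'r::finite"
  assumes J: "card J \<le> d + e" and e: "e \<le> d" and v: "card {j\<in>J. v $ j = 1} \<noteq> e"
  shows "\<exists>L. vec.subspace L \<and> CARD('r) \<le> vec.dim L + d \<and>
    (\<forall>x\<in>L. card {j\<in>J. (v + x) $ j = 1} \<noteq> e)"
proof -
  define P where "P u b = {j\<in>J. u $ j = b}" for u :: "bit ^ 'r" and b
  have card_P: "card (P u 0) + card (P u 1) = card J" for u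
  proof -
    have "card (P u 0) + card (P u 1) = card (P u 0 \<union> P u 1)"
      by (rule card_Un_disjoint[symmetric]) (auto simp: P_def)
    also have "P u 0 \<union> P u 1 = J"
      by (auto simp: P_def)
    finally show ?thesis .
  qed
  \<comment> \<open>The value that \<open>v\<close> takes too often on \<open>J\<close>: 1 if there
    are more than \<open>e\<close> ones, otherwise 0, since the weight differs from \<open>e\<close>
    and is then smaller.\<close>
  define b :: bit where "b = (if e < card (P v 1) then 1 else 0)"
  have "\<exists>L. vec.subspace L \<and> CARD('r) \<le> vec.dim L + d \<and> (\<forall>x\<in>L. card (P (v + x) 1) \<noteq> e)"
  proof (cases "card (P v b) \<le> d")
    case True
    let ?L = "{x. \<forall>j\<in>P v b. x $ j = 0}"
    have "card (P (v + x) 1) \<noteq> e" if "x \<in> ?L" for x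
    proof -
      \<comment> \<open>Adding \<open>x\<close> keeps these entries in place, so their excess
        persists and the weight stays on the same side of \<open>e\<close>.\<close>
      have "P v b \<subseteq> P (v + x) b"
        using that by (auto simp: P_def)
      then have "card (P v b) \<le> card (P (v + x) b)"
        by (simp add: card_mono)
      moreover have "card (P v 1) \<noteq> e"
        using v by (simp add: P_def)
      ultimately show ?thesis
        using card_P[of v] card_P[of "v + x"] by (simp add: b_def split: if_splits)
    qed
    then show ?thesis
      using True dim_vanishing[of "P v b", where 'a=bit] by (intro exI[of _ ?L]) auto
  next
    case False
    then obtain T where T: "T \<subseteq> P v b" "card T = d + 1"
      using obtain_subset_with_card_n[of "d + 1" "P v b"] by auto
    let ?L = "{x :: bit ^ 'r. \<exists>c. \<forall>j\<in>T. x $ j = c}"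
    have "card (P (v + x) 1) \<noteq> e" if x: "x \<in> ?L" for x
    proof -
      obtain c where "\<forall>j\<in>T. x $ j = c"
        using x by blast
      then have "T \<subseteq> P (v + x) (b + c)"
        using T(1) by (auto simp: P_def)
      \<comment> \<open>The constant depends on \<open>x\<close>, so both values of \<open>a\<close>
        have to be excluded: 1 by \<open>e\<close>, 0 by \<open>J\<close>.\<close>
      then obtain a where "T \<subseteq> P (v + x) a"
        by blast
      then have "card T \<le> card (P (v + x) a)"
        by (simp add: card_mono)
      then show ?thesis
        using card_P[of "v + x"] T(2) J e by (cases a) auto
    qed
    moreover have "T \<noteq> {}"
      using T(2) by auto
    ultimately show ?thesis
      using dim_constant_on[of T, where 'a=bit] T(2) by (intro exI[of _ ?L]) auto
  qed
  then show ?thesis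
    by (simp only: P_def)
qed

section \<open>Vectors with prescribed weights on the blocks\<close>

definition block_weights ::
    "nat set \<Rightarrow> (nat \<Rightarrow> 'r::finite set) \<Rightarrow> (nat \<Rightarrow> nat) \<Rightarrow> (bit ^ 'r) set" where
  "block_weights K I ds = {y. (\<forall>i\<in>K. card {j\<in>I i. y $ j = 1} = ds i) \<and>
     (\<forall>j. j \<notin> (\<Union>i\<in>K. I i) \<longrightarrow> y $ j = 0)}"

lemma non_blocking_block_weights:
  fixes I :: "nat \<Rightarrow> 'r::finite set"
  assumes d: "1 \<le> d" "d \<le> CARD('r)" and K: "finite K"
    and sum: "(\<Sum>i\<in>K. ds i) \<le> d" and le: "\<And>i. i \<in> K \<Longrightarrow> card (I i) \<le> d + ds i"
  shows "non_blocking d (block_weights K I ds)"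
proof (rule non_blockingI[OF d(2)])
  fix v :: "bit ^ 'r"
  let ?B = "block_weights K I ds"
  let ?goal = "\<exists>L. vec.subspace L \<and> CARD('r) \<le> vec.dim L + d \<and> (\<forall>x\<in>L. v + x \<in> ?B \<longrightarrow> x = 0)"
  consider (weight) i where "i \<in> K" "card {j\<in>I i. v $ j = 1} \<noteq> ds i"
    | (outside) j where "j \<notin> (\<Union>i\<in>K. I i)" "v $ j \<noteq> 0"
    | (mem) "v \<in> ?B"
    unfolding block_weights_def by blast
  then show ?goal
  proof cases
    case weight
    have "ds i \<le> d"
      using member_le_sum[of i K ds] weight(1) K sum by simp
    then show ?thesis
      using avoid_weight[OF le[OF weight(1)] _ weight(2)] weight(1)
      unfolding block_weights_def by blast
  next
    case outside
    \<comment> \<open>Fixing one coordinate costs codimension 1, which \<open>1 \<le> d\<close>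
      allows.\<close>
    let ?L = "{x :: bit ^ 'r. \<forall>i\<in>{j}. x $ i = 0}"
    have "v + x \<notin> ?B" if "x \<in> ?L" for x
      using that outside unfolding block_weights_def by fastforce
    then show ?thesis
      using d dim_vanishing[of "{j}", where 'a=bit] by (intro exI[of _ ?L]) auto
  next
    case mem
    let ?S = "\<Union>i\<in>K. {j\<in>I i. v $ j = 1}"
    let ?L = "{x :: bit ^ 'r. \<forall>j\<in>?S. x $ j = 0}"
    have "card ?S \<le> (\<Sum>i\<in>K. card {j\<in>I i. v $ j = 1})"
      using K by (rule card_UN_le)
    also have "\<dots> \<le> d"
      using mem sum by (simp add: block_weights_def)
    finally have "card ?S \<le> d" .
    moreover have "x = 0" if x: "x \<in> ?L" and B: "v + x \<in> ?B" for x
    proof -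
      have "x $ j = 0" for j
      proof (cases "j \<in> (\<Union>i\<in>K. I i)")
        case True
        then obtain i where i: "i \<in> K" "j \<in> I i"
          by blast
        \<comment> \<open>As \<open>x\<close> vanishes on \<open>?S\<close>, the left set is
          contained in the right one; both have size \<open>ds i\<close>.\<close>
        have "{j\<in>I i. v $ j = 1} = {j\<in>I i. (v + x) $ j = 1}"
          using x i(1) mem B by (intro card_subset_eq) (auto simp: block_weights_def)
        then have "v $ j = 1 \<longleftrightarrow> (v + x) $ j = 1"
          using i(2) by blast
        then have "(v + x) $ j = v $ j"
          by (metis bit_not_one_iff)
        then show ?thesis
          by (simp del: add_bit_eq_xor)
      next
        case False
        then have "v $ j = 0" "(v + x) $ j = 0"
          using mem B unfolding block_weights_def by blast+
        then show ?thesis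
          by (simp del: add_bit_eq_xor)
      qed
      then show ?thesis
        by (simp add: vec_eq_iff)
    qed
    ultimately show ?thesis
      using dim_vanishing[of ?S, where 'a=bit] by (intro exI[of _ ?L]) auto
  qed
qed

text \<open>Choose a \<open>ds i\<close>-subset of each block and take the indicator vector of their
  union. This is injective: by disjointness, the ones on \<open>I i\<close> recover the chosen
  subset.\<close>

lemma card_block_weights:
  fixes I :: "nat \<Rightarrow> 'r::finite set"
  assumes K: "finite K" and disj: "disjoint_family_on I K"
  shows "(\<Prod>i\<in>K. card (I i) choose ds i) \<le> card (block_weights K I ds)"
proof -
  let ?P = "PiE K (\<lambda>i. {S. S \<subseteq> I i \<and> card S = ds i})"
  let ?f = "\<lambda>F. (\<chi> j. if j \<in> (\<Union>i\<in>K. F i) then 1 else 0) :: bit ^ 'r"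
  have f_1: "{j\<in>I i. ?f F $ j = 1} = F i" if F: "F \<in> ?P" and i: "i \<in> K" for F i
  proof (intro equalityI subsetI)
    fix j assume "j \<in> {j\<in>I i. ?f F $ j = 1}"
    then obtain i' where i': "i' \<in> K" "j \<in> F i'" and j: "j \<in> I i"
      by (auto split: if_splits)
    moreover have "j \<in> I i'"
      using PiE_mem[OF F i'(1)] i'(2) by auto
    ultimately have "i' = i"
      using disj i unfolding disjoint_family_on_def by blast
    with i' show "j \<in> F i"
      by simp
  next
    fix j assume "j \<in> F i"
    then show "j \<in> {j\<in>I i. ?f F $ j = 1}"
      using PiE_mem[OF F i] i by auto
  qed
  have "inj_on ?f ?P"
  proof (rule inj_onI)
    fix F G assume F: "F \<in> ?P" and G: "G \<in> ?P" and eq: "?f F = ?f G"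
    show "F = G"
      using f_1[OF F] f_1[OF G] unfolding eq by (intro PiE_ext[OF F G]) simp
  qed
  moreover have "?f ` ?P \<subseteq> block_weights K I ds"
  proof
    fix y assume "y \<in> ?f ` ?P"
    then obtain F where F: "F \<in> ?P" and y: "y = ?f F"
      by blast
    have "card {j\<in>I i. y $ j = 1} = ds i" if "i \<in> K" for i
      using f_1[OF F that] PiE_mem[OF F that] unfolding y by simp
    moreover have "y $ j = 0" if "j \<notin> (\<Union>i\<in>K. I i)" for j
      using that PiE_mem[OF F] unfolding y by fastforce
    ultimately show "y \<in> block_weights K I ds"
      unfolding block_weights_def by blast
  qed
  ultimately have "card ?P \<le> card (block_weights K I ds)"
    using finite_subset[OF subset_UNIV finite_UNIV_bit_vec] by (rule card_inj_on_le)
  then show ?thesis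
    using K by (simp add: card_PiE n_subsets)
qed

text \<open>Greedy choice: remove a set \<open>S\<close> of the first size from \<open>A\<close>;
  what remains is large enough for the other sizes.\<close>

lemma obtain_disjoint_family_with_cards:
  fixes A :: "'a set" and n :: "'i \<Rightarrow> nat"
  assumes "finite K" "finite A" "(\<Sum>i\<in>K. n i) \<le> card A"
  obtains I where "disjoint_family_on I K" "\<And>i. i \<in> K \<Longrightarrow> I i \<subseteq> A \<and> card (I i) = n i"
proof -
  have "\<exists>I. disjoint_family_on I K \<and> (\<forall>i\<in>K. I i \<subseteq> A \<and> card (I i) = n i)"
    using assms
  proof (induction K arbitrary: A)
    case empty
    then show ?case
      by (simp add: disjoint_family_on_def)
  next
    case (insert k K)
    have "n k \<le> card A"
      using insert.hyps insert.prems by simp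
    then obtain S where S: "S \<subseteq> A" "card S = n k"
      by (rule obtain_subset_with_card_n)
    have "(\<Sum>i\<in>K. n i) \<le> card (A - S)"
      using insert.hyps insert.prems S by (simp add: card_Diff_subset finite_subset)
    then obtain I where I: "disjoint_family_on I K" "\<forall>i\<in>K. I i \<subseteq> A - S \<and> card (I i) = n i"
      using insert.IH[of "A - S"] insert.prems(1) by blast
    have "disjoint_family_on (I(k := S)) (insert k K)"
      unfolding disjoint_family_on_def
    proof (intro ballI impI)
      fix i j assume "i \<in> insert k K" "j \<in> insert k K" "i \<noteq> j"
      then show "(I(k := S)) i \<inter> (I(k := S)) j = {}"
        using I unfolding disjoint_family_on_def by (cases "i = k"; cases "j = k") auto
    qed
    moreover have "\<forall>i\<in>insert k K. (I(k := S)) i \<subseteq> A \<and> card ((I(k := S)) i) = n i"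
      using I S by auto
    ultimately show ?case
      by blast
  qed
  then show ?thesis
    using that by blast
qed

theorem theorem9:
  fixes d k :: nat and rs ds :: "nat \<Rightarrow> nat"
  assumes "1 \<le> d" and "d \<le> CARD('r::finite)" and "1 \<le> k"
    and "\<forall>i\<in>{1..k}. ds i \<le> rs i"
    and "(\<Sum>i=1..k. rs i) \<le> CARD('r)"
    and "(\<Sum>i=1..k. ds i) \<le> d"
    and "\<forall>i\<in>{1..k}. rs i \<le> d + ds i"
  shows "beta TYPE('r) d \<ge> (\<Prod>i=1..k. rs i choose ds i)"
proof -
  obtain I :: "nat \<Rightarrow> 'r set" where disj: "disjoint_family_on I {1..k}"
    and card_I: "\<And>i. i \<in> {1..k} \<Longrightarrow> card (I i) = rs i"
    using obtain_disjoint_family_with_cards[of "{1..k}" "UNIV :: 'r set" rs] assms(5) by auto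
  have "(\<Prod>i=1..k. rs i choose ds i) = (\<Prod>i=1..k. card (I i) choose ds i)"
    using card_I by (intro prod.cong) auto
  also have "\<dots> \<le> card (block_weights {1..k} I ds)"
    using disj by (intro card_block_weights) auto
  also have "\<dots> \<le> beta TYPE('r) d"
    using assms card_I by (intro card_le_beta non_blocking_block_weights) auto
  finally show ?thesis .
qed

end
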